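(* Let $A$ be a ring, $E$ an $A$-module and $S=A\setminus (Z(A)\cup Z(E))$. Assume that $E=sE$ for every $s\in S$. Then the trivial ring extension $A\propto E$ is an ISP-ring if and only if every proper ideal $I$ of $A$ with $I\cap S\neq\emptyset$ can be written as $I=JH_1\cdots H_n$ with $J$ an invertible ideal of $A$, $n\geq 1$, and all $H_i$ proper radical ideals of $A$.
   Context: All rings are commutative with a nonzero unit; modules are unitary. $Z(A)$ is the set of zero-divisors of $A$ and $Z(E)$ is the set of zero-divisors on $E$, i.e. of $a\in A$ with $ae=0$ for some $0\ne e\in E$. The trivial ring extension $A\propto E$ is the ring with underlying additive group $A\times E$ and multiplication $(a,e)(b,f)=(ab,af+be)$. An element of a ring is regular if it is not a zero-divisor; an ideal is regular if it contains at least one regular element. A proper ideal $H$ is a radical ideal if $\sqrt H=H$. An ideal $J$ of $A$ is invertible if $JJ'=A$ for some $A$-submodule $J'$ of the total quotient ring $T(A)$; equivalently, $J$ is finitely generated, regular, and $J_M$ is a principal ideal of $A_M$ for each maximal ideal $M$ of $A$ (the ideal $A$ itself is allowed). A ring is an ISP-ring if every proper regular ideal of it can be written as $JH_1\cdots H_n$ with $J$ an invertible ideal, $n\ge 1$, and all $H_i$ proper radical ideals. *)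

theory Defs
  imports "HOL-Algebra.Algebra"
begin

section \<open>Zero-divisors and regular elements\<close>

text \<open>In a nonzero ring, \<open>\<zero>\<close> counts as a zero-divisor.\<close>

definition zero_divisors :: "('a, 'm) ring_scheme \<Rightarrow> 'a set"
  where "zero_divisors R =
    {a \<in> carrier R. \<exists>b \<in> carrier R. b \<noteq> \<zero>\<^bsub>R\<^esub> \<and> a \<otimes>\<^bsub>R\<^esub> b = \<zero>\<^bsub>R\<^esub>}"

definition zero_divisors_on ::
    "('a, 'm) ring_scheme \<Rightarrow> ('a, 'e, 'n) module_scheme \<Rightarrow> 'a set"
  where "zero_divisors_on R E =
    {a \<in> carrier R. \<exists>e \<in> carrier E. e \<noteq> \<zero>\<^bsub>E\<^esub> \<and> a \<odot>\<^bsub>E\<^esub> e = \<zero>\<^bsub>E\<^esub>}"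

definition regular_elements :: "('a, 'm) ring_scheme \<Rightarrow> 'a set"
  where "regular_elements R = carrier R - zero_divisors R"

definition regular_ideal :: "('a, 'm) ring_scheme \<Rightarrow> 'a set \<Rightarrow> bool"
  where "regular_ideal R I \<longleftrightarrow> ideal I R \<and> I \<inter> regular_elements R \<noteq> {}"


section \<open>The trivial ring extension\<close>

definition trivial_extension ::
    "('a, 'm) ring_scheme \<Rightarrow> ('a, 'e, 'n) module_scheme \<Rightarrow> ('a \<times> 'e) ring"
  where "trivial_extension R E =
    \<lparr>carrier = carrier R \<times> carrier E,
     monoid.mult = (\<lambda>(a, e) (b, f). (a \<otimes>\<^bsub>R\<^esub> b, a \<odot>\<^bsub>E\<^esub> f \<oplus>\<^bsub>E\<^esub> b \<odot>\<^bsub>E\<^esub> e)),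
     one = (\<one>\<^bsub>R\<^esub>, \<zero>\<^bsub>E\<^esub>),
     ring.zero = (\<zero>\<^bsub>R\<^esub>, \<zero>\<^bsub>E\<^esub>),
     ring.add = (\<lambda>(a, e) (b, f). (a \<oplus>\<^bsub>R\<^esub> b, e \<oplus>\<^bsub>E\<^esub> f))\<rparr>"

lemma (in module) cring_trivial_extension: "cring (trivial_extension R M)"
proof (rule cringI)
  show "abelian_group (trivial_extension R M)"
  proof (rule abelian_groupI)
    fix x assume "x \<in> carrier (trivial_extension R M)"
    then obtain a e where x: "x = (a, e)" "a \<in> carrier R" "e \<in> carrier M"
      by (auto simp: trivial_extension_def)
    show "\<exists>y\<in>carrier (trivial_extension R M).
        y \<oplus>\<^bsub>trivial_extension R M\<^esub> x = \<zero>\<^bsub>trivial_extension R M\<^esub>"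
      by (rule bexI[of _ "(\<ominus> a, \<ominus>\<^bsub>M\<^esub> e)"])
        (use x in \<open>auto simp: trivial_extension_def R.l_neg M.l_neg\<close>)
  qed (auto simp: trivial_extension_def R.a_ac M.a_ac)
  show "Group.comm_monoid (trivial_extension R M)"
    by (rule comm_monoidI)
      (auto simp: trivial_extension_def R.m_ac M.a_ac smult_r_distr smult_assoc1[symmetric])
qed (auto simp: trivial_extension_def R.l_distr smult_l_distr smult_r_distr M.a_ac)


section \<open>The total quotient ring\<close>

text \<open>
  The class of \<open>a / s\<close>. As denominators are regular, \<open>a / s = b / t\<close> just means
  \<open>a t = b s\<close>.
\<close>

definition fraction :: "('a, 'm) ring_scheme \<Rightarrow> 'a \<Rightarrow> 'a \<Rightarrow> ('a \<times> 'a) set"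
  where "fraction R a s =
    {(b, t). b \<in> carrier R \<and> t \<in> regular_elements R \<and> a \<otimes>\<^bsub>R\<^esub> t = b \<otimes>\<^bsub>R\<^esub> s}"

text \<open>
  The total quotient ring, with its \<open>R\<close>-module structure in the field \<open>smult\<close>. The unions in
  the operations range over equal sets, by the lemmas \<open>fraction_mult\<close> and \<open>fraction_add\<close>.
\<close>

definition total_quotient_ring ::
    "('a, 'm) ring_scheme \<Rightarrow> ('a, ('a \<times> 'a) set) module"
  where "total_quotient_ring R =
    \<lparr>carrier = {fraction R a s | a s. a \<in> carrier R \<and> s \<in> regular_elements R},
     monoid.mult = (\<lambda>x y. \<Union>(a, s) \<in> x. \<Union>(b, t) \<in> y. fraction R (a \<otimes>\<^bsub>R\<^esub> b) (s \<otimes>\<^bsub>R\<^esub> t)),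
     one = fraction R \<one>\<^bsub>R\<^esub> \<one>\<^bsub>R\<^esub>,
     ring.zero = fraction R \<zero>\<^bsub>R\<^esub> \<one>\<^bsub>R\<^esub>,
     ring.add = (\<lambda>x y. \<Union>(a, s) \<in> x. \<Union>(b, t) \<in> y.
              fraction R (a \<otimes>\<^bsub>R\<^esub> t \<oplus>\<^bsub>R\<^esub> b \<otimes>\<^bsub>R\<^esub> s) (s \<otimes>\<^bsub>R\<^esub> t)),
     smult = (\<lambda>r x. \<Union>(a, s) \<in> x. fraction R (r \<otimes>\<^bsub>R\<^esub> a) s)\<rparr>"

definition to_total_quotient :: "('a, 'm) ring_scheme \<Rightarrow> 'a \<Rightarrow> ('a \<times> 'a) set"
  where "to_total_quotient R a = fraction R a \<one>\<^bsub>R\<^esub>"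

lemma UN_pair_const:
  assumes "\<And>a s. (a, s) \<in> P \<Longrightarrow> F a s = C" and "P \<noteq> {}"
  shows "(\<Union>(a, s) \<in> P. F a s) = C"
proof -
  have "(\<Union>(a, s) \<in> P. F a s) = (\<Union>p \<in> P. C)" using assms(1) by auto
  then show ?thesis using assms(2) by simp
qed

context cring
begin

lemma regular_carrier [simp]: "s \<in> regular_elements R \<Longrightarrow> s \<in> carrier R"
  by (simp add: regular_elements_def)

lemma regular_cancel:
  assumes "s \<in> regular_elements R" "a \<in> carrier R" "b \<in> carrier R" "a \<otimes> s = b \<otimes> s"
  shows "a = b"
proof -
  have s: "s \<in> carrier R" using assms(1) by simp
  have "s \<otimes> (a \<ominus> b) = \<zero>"
    using assms(2-4) s by (simp add: a_minus_def r_distr r_minus m_comm r_neg)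
  with assms s have "a \<ominus> b = \<zero>"
    unfolding regular_elements_def zero_divisors_def
    by (metis (mono_tags, lifting) DiffD2 mem_Collect_eq minus_closed)
  with assms(2,3) show ?thesis by simp
qed

lemma regular_mult [simp]:
  assumes "s \<in> regular_elements R" "t \<in> regular_elements R"
  shows "s \<otimes> t \<in> regular_elements R"
proof -
  have st: "s \<in> carrier R" "t \<in> carrier R" using assms by simp_all
  have "b = \<zero>" if b: "b \<in> carrier R" "s \<otimes> t \<otimes> b = \<zero>" for b
  proof -
    have "(t \<otimes> b) \<otimes> s = \<zero> \<otimes> s" using b st by (simp add: m_ac)
    then have "t \<otimes> b = \<zero>" using regular_cancel[OF assms(1), of "t \<otimes> b" \<zero>] b st by simp
    then have "b \<otimes> t = \<zero> \<otimes> t" using b st by (simp add: m_ac)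
    then show ?thesis using regular_cancel[OF assms(2), of b \<zero>] b by simp
  qed
  moreover have "s \<otimes> t \<in> carrier R" using st by simp
  ultimately show ?thesis unfolding regular_elements_def zero_divisors_def by blast
qed

lemma regular_one [simp]: "\<one> \<in> regular_elements R"
  unfolding regular_elements_def zero_divisors_def using l_one one_closed by fastforce

lemma fraction_self:
  "a \<in> carrier R \<Longrightarrow> s \<in> regular_elements R \<Longrightarrow> (a, s) \<in> fraction R a s"
  by (simp add: fraction_def)

lemma fraction_memD:
  assumes "(b, t) \<in> fraction R a s"
  shows "b \<in> carrier R" "t \<in> regular_elements R" "a \<otimes> t = b \<otimes> s"
  using assms by (auto simp: fraction_def)

lemma fraction_eqI:
  assumes "a \<in> carrier R" "s \<in> regular_elements R" "b \<in> carrier R" "t \<in> regular_elements R"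
    and "a \<otimes> t = b \<otimes> s"
  shows "fraction R a s = fraction R b t"
proof -
  have key: "b' \<otimes> u = c \<otimes> t'"
    if "a' \<in> carrier R" "s' \<in> regular_elements R" "b' \<in> carrier R" "t' \<in> regular_elements R"
      "a' \<otimes> t' = b' \<otimes> s'" "c \<in> carrier R" "u \<in> regular_elements R" "a' \<otimes> u = c \<otimes> s'"
    for a' s' b' t' c u
  proof (rule regular_cancel[OF that(2)])
    have cl: "s' \<in> carrier R" "t' \<in> carrier R" "u \<in> carrier R" using that by simp_all
    have "b' \<otimes> u \<otimes> s' = (b' \<otimes> s') \<otimes> u" using that(3) cl by (simp add: m_ac)
    also have "\<dots> = (a' \<otimes> t') \<otimes> u" by (simp only: that(5))
    also have "\<dots> = (a' \<otimes> u) \<otimes> t'" using that(1) cl by (simp add: m_ac)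
    also have "\<dots> = (c \<otimes> s') \<otimes> t'" by (simp only: that(8))
    also have "\<dots> = c \<otimes> t' \<otimes> s'" using that(6) cl by (simp add: m_ac)
    finally show "b' \<otimes> u \<otimes> s' = c \<otimes> t' \<otimes> s'" .
  qed (use that in auto)
  show ?thesis
    using key[OF assms] key[OF assms(3,4,1,2) assms(5)[symmetric]]
    by (auto simp: fraction_def)
qed

lemma fraction_eq_iff:
  assumes "a \<in> carrier R" "s \<in> regular_elements R" "b \<in> carrier R" "t \<in> regular_elements R"
  shows "fraction R a s = fraction R b t \<longleftrightarrow> a \<otimes> t = b \<otimes> s"
proof
  assume "fraction R a s = fraction R b t"
  then have "(b, t) \<in> fraction R a s" using fraction_self assms by blast
  then show "a \<otimes> t = b \<otimes> s" by (rule fraction_memD)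
qed (rule fraction_eqI[OF assms])

lemma fraction_mult:
  assumes "a \<in> carrier R" "s \<in> regular_elements R" "b \<in> carrier R" "t \<in> regular_elements R"
  shows "fraction R a s \<otimes>\<^bsub>total_quotient_ring R\<^esub> fraction R b t
    = fraction R (a \<otimes> b) (s \<otimes> t)"
proof -
  have "fraction R (a' \<otimes> b') (s' \<otimes> t') = fraction R (a \<otimes> b) (s \<otimes> t)"
    if "(a', s') \<in> fraction R a s" "(b', t') \<in> fraction R b t" for a' s' b' t'
  proof (rule fraction_eqI)
    note d = fraction_memD[OF that(1)] fraction_memD[OF that(2)]
    have cl: "s \<in> carrier R" "t \<in> carrier R" "s' \<in> carrier R" "t' \<in> carrier R"
      using assms d by simp_all
    have "a' \<otimes> b' \<otimes> (s \<otimes> t) = (a' \<otimes> s) \<otimes> (b' \<otimes> t)"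
      using assms(1,3) d(1,4) cl by (simp add: m_ac)
    also have "\<dots> = (a \<otimes> s') \<otimes> (b \<otimes> t')" using d by simp
    also have "\<dots> = a \<otimes> b \<otimes> (s' \<otimes> t')" using assms(1,3) d(1,4) cl by (simp add: m_ac)
    finally show "a' \<otimes> b' \<otimes> (s \<otimes> t) = a \<otimes> b \<otimes> (s' \<otimes> t')" .
  qed (use assms fraction_memD[OF that(1)] fraction_memD[OF that(2)] in auto)
  then show ?thesis
    using fraction_self[OF assms(1,2)] fraction_self[OF assms(3,4)]
    unfolding total_quotient_ring_def ring.simps monoid.simps
    by (intro UN_pair_const) blast+
qed

lemma fraction_add:
  assumes "a \<in> carrier R" "s \<in> regular_elements R" "b \<in> carrier R" "t \<in> regular_elements R"
  shows "fraction R a s \<oplus>\<^bsub>total_quotient_ring R\<^esub> fraction R b t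
    = fraction R (a \<otimes> t \<oplus> b \<otimes> s) (s \<otimes> t)"
proof -
  have "fraction R (a' \<otimes> t' \<oplus> b' \<otimes> s') (s' \<otimes> t') = fraction R (a \<otimes> t \<oplus> b \<otimes> s) (s \<otimes> t)"
    if "(a', s') \<in> fraction R a s" "(b', t') \<in> fraction R b t" for a' s' b' t'
  proof (rule fraction_eqI)
    note d = fraction_memD[OF that(1)] fraction_memD[OF that(2)]
    have cl: "s \<in> carrier R" "t \<in> carrier R" "s' \<in> carrier R" "t' \<in> carrier R"
      using assms d by simp_all
    have "(a' \<otimes> t' \<oplus> b' \<otimes> s') \<otimes> (s \<otimes> t)
        = (a' \<otimes> s) \<otimes> (t \<otimes> t') \<oplus> (b' \<otimes> t) \<otimes> (s \<otimes> s')"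
      using assms(1,3) d(1,4) cl by (simp add: m_ac l_distr r_distr a_ac)
    also have "\<dots> = (a \<otimes> s') \<otimes> (t \<otimes> t') \<oplus> (b \<otimes> t') \<otimes> (s \<otimes> s')" using d by simp
    also have "\<dots> = (a \<otimes> t \<oplus> b \<otimes> s) \<otimes> (s' \<otimes> t')"
      using assms(1,3) d(1,4) cl by (simp add: m_ac l_distr r_distr a_ac)
    finally show "(a' \<otimes> t' \<oplus> b' \<otimes> s') \<otimes> (s \<otimes> t) = (a \<otimes> t \<oplus> b \<otimes> s) \<otimes> (s' \<otimes> t')" .
  qed (use assms fraction_memD[OF that(1)] fraction_memD[OF that(2)] in auto)
  then show ?thesis
    using fraction_self[OF assms(1,2)] fraction_self[OF assms(3,4)]
    unfolding total_quotient_ring_def ring.simps monoid.simps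
    by (intro UN_pair_const) blast+
qed

lemma fraction_smult:
  assumes "r \<in> carrier R" "a \<in> carrier R" "s \<in> regular_elements R"
  shows "r \<odot>\<^bsub>total_quotient_ring R\<^esub> fraction R a s = fraction R (r \<otimes> a) s"
proof -
  have "fraction R (r \<otimes> a') s' = fraction R (r \<otimes> a) s"
    if "(a', s') \<in> fraction R a s" for a' s'
    using assms fraction_memD[OF that] by (intro fraction_eqI) (auto simp: m_assoc)
  then show ?thesis
    using fraction_self[OF assms(2,3)]
    unfolding total_quotient_ring_def module.simps
    by (intro UN_pair_const) blast+
qed

lemma total_quotient_simps:
  "carrier (total_quotient_ring R)
    = {fraction R a s | a s. a \<in> carrier R \<and> s \<in> regular_elements R}"
  "\<one>\<^bsub>total_quotient_ring R\<^esub> = fraction R \<one> \<one>"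
  "\<zero>\<^bsub>total_quotient_ring R\<^esub> = fraction R \<zero> \<one>"
  by (simp_all add: total_quotient_ring_def)

lemma fraction_closed [simp]:
  "a \<in> carrier R \<Longrightarrow> s \<in> regular_elements R
    \<Longrightarrow> fraction R a s \<in> carrier (total_quotient_ring R)"
  unfolding total_quotient_simps by blast

lemma total_quotient_cases:
  assumes "x \<in> carrier (total_quotient_ring R)"
  obtains a s where "x = fraction R a s" "a \<in> carrier R" "s \<in> regular_elements R"
  using assms unfolding total_quotient_simps by blast

lemma cring_total_quotient_ring: "cring (total_quotient_ring R)"
proof (rule cringI)
  let ?T = "total_quotient_ring R"
  note simps = total_quotient_simps(2,3) fraction_mult fraction_add
  show "abelian_group ?T"
  proof (rule abelian_groupI)
    fix x y assume "x \<in> carrier ?T" "y \<in> carrier ?T"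
    then obtain a s b t where
      x: "x = fraction R a s" "a \<in> carrier R" "s \<in> regular_elements R" and
      y: "y = fraction R b t" "b \<in> carrier R" "t \<in> regular_elements R"
      by (elim total_quotient_cases)
    show "x \<oplus>\<^bsub>?T\<^esub> y \<in> carrier ?T" using x y by (simp add: simps)
    show "x \<oplus>\<^bsub>?T\<^esub> y = y \<oplus>\<^bsub>?T\<^esub> x"
      using x y by (simp add: simps m_comm[of s t] a_comm)
    fix z assume "z \<in> carrier ?T"
    then obtain c u where z: "z = fraction R c u" "c \<in> carrier R" "u \<in> regular_elements R"
      by (elim total_quotient_cases)
    have "(a \<otimes> t \<oplus> b \<otimes> s) \<otimes> u \<oplus> c \<otimes> (s \<otimes> t) = a \<otimes> (t \<otimes> u) \<oplus> (b \<otimes> u \<oplus> c \<otimes> t) \<otimes> s"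
      using x y z by (simp add: l_distr r_distr m_ac a_ac)
    then show "x \<oplus>\<^bsub>?T\<^esub> y \<oplus>\<^bsub>?T\<^esub> z = x \<oplus>\<^bsub>?T\<^esub> (y \<oplus>\<^bsub>?T\<^esub> z)"
      using x y z by (simp add: simps m_assoc[of s t u])
  next
    show "\<zero>\<^bsub>?T\<^esub> \<in> carrier ?T" by (simp add: simps)
    fix x assume "x \<in> carrier ?T"
    then obtain a s where x: "x = fraction R a s" "a \<in> carrier R" "s \<in> regular_elements R"
      by (rule total_quotient_cases)
    show "\<zero>\<^bsub>?T\<^esub> \<oplus>\<^bsub>?T\<^esub> x = x" using x by (simp add: simps)
    have "fraction R (\<ominus> a) s \<oplus>\<^bsub>?T\<^esub> x = \<zero>\<^bsub>?T\<^esub>"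
      using x by (simp add: simps fraction_eq_iff l_minus l_neg)
    then show "\<exists>y \<in> carrier ?T. y \<oplus>\<^bsub>?T\<^esub> x = \<zero>\<^bsub>?T\<^esub>"
      using x by (meson a_inv_closed fraction_closed)
  qed
  show "Group.comm_monoid ?T"
  proof (rule comm_monoidI)
    show "\<one>\<^bsub>?T\<^esub> \<in> carrier ?T" by (simp add: simps)
    fix x assume "x \<in> carrier ?T"
    then obtain a s where x: "x = fraction R a s" "a \<in> carrier R" "s \<in> regular_elements R"
      by (rule total_quotient_cases)
    show "\<one>\<^bsub>?T\<^esub> \<otimes>\<^bsub>?T\<^esub> x = x" using x by (simp add: simps)
    fix y assume "y \<in> carrier ?T"
    then obtain b t where y: "y = fraction R b t" "b \<in> carrier R" "t \<in> regular_elements R"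
      by (rule total_quotient_cases)
    show "x \<otimes>\<^bsub>?T\<^esub> y \<in> carrier ?T" using x y by (simp add: simps)
    show "x \<otimes>\<^bsub>?T\<^esub> y = y \<otimes>\<^bsub>?T\<^esub> x"
      using x y by (simp add: simps m_comm[of s t] m_comm[of a b])
    fix z assume "z \<in> carrier ?T"
    then obtain c u where z: "z = fraction R c u" "c \<in> carrier R" "u \<in> regular_elements R"
      by (rule total_quotient_cases)
    show "x \<otimes>\<^bsub>?T\<^esub> y \<otimes>\<^bsub>?T\<^esub> z = x \<otimes>\<^bsub>?T\<^esub> (y \<otimes>\<^bsub>?T\<^esub> z)"
      using x y z by (simp add: simps m_assoc)
  qed
  fix x y z assume "x \<in> carrier ?T" "y \<in> carrier ?T" "z \<in> carrier ?T"
  then obtain a s b t c u where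
    x: "x = fraction R a s" "a \<in> carrier R" "s \<in> regular_elements R" and
    y: "y = fraction R b t" "b \<in> carrier R" "t \<in> regular_elements R" and
    z: "z = fraction R c u" "c \<in> carrier R" "u \<in> regular_elements R"
    by (elim total_quotient_cases)
  have "fraction R ((a \<otimes> t \<oplus> b \<otimes> s) \<otimes> c) (s \<otimes> t \<otimes> u)
      = fraction R (a \<otimes> c \<otimes> (t \<otimes> u) \<oplus> b \<otimes> c \<otimes> (s \<otimes> u)) (s \<otimes> u \<otimes> (t \<otimes> u))"
    using x y z by (intro fraction_eqI) (simp_all add: l_distr r_distr m_ac)
  then show "(x \<oplus>\<^bsub>?T\<^esub> y) \<otimes>\<^bsub>?T\<^esub> z = x \<otimes>\<^bsub>?T\<^esub> z \<oplus>\<^bsub>?T\<^esub> y \<otimes>\<^bsub>?T\<^esub> z"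
    using x y z by (simp add: simps)
qed

lemma module_total_quotient_ring: "module R (total_quotient_ring R)"
proof (rule moduleI)
  let ?T = "total_quotient_ring R"
  interpret T: cring ?T by (rule cring_total_quotient_ring)
  note simps = total_quotient_simps(2,3) fraction_smult fraction_add
  show "cring R" by (rule cring_axioms)
  show "abelian_group ?T" by (rule T.abelian_group_axioms)
  fix x assume "x \<in> carrier ?T"
  then obtain c s where x: "x = fraction R c s" "c \<in> carrier R" "s \<in> regular_elements R"
    by (rule total_quotient_cases)
  show "\<one> \<odot>\<^bsub>?T\<^esub> x = x" using x by (simp add: simps)
  fix a assume a: "a \<in> carrier R"
  show "a \<odot>\<^bsub>?T\<^esub> x \<in> carrier ?T" using a x by (simp add: simps)
  {
    fix b assume b: "b \<in> carrier R"
    have "fraction R ((a \<oplus> b) \<otimes> c) s = fraction R (a \<otimes> c \<otimes> s \<oplus> b \<otimes> c \<otimes> s) (s \<otimes> s)"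
      using a b x by (intro fraction_eqI) (simp_all add: l_distr r_distr m_ac)
    then show "(a \<oplus> b) \<odot>\<^bsub>?T\<^esub> x = a \<odot>\<^bsub>?T\<^esub> x \<oplus>\<^bsub>?T\<^esub> b \<odot>\<^bsub>?T\<^esub> x"
      using a b x by (simp add: simps)
    show "(a \<otimes> b) \<odot>\<^bsub>?T\<^esub> x = a \<odot>\<^bsub>?T\<^esub> (b \<odot>\<^bsub>?T\<^esub> x)"
      using a b x by (simp add: simps m_assoc)
  }
  fix y assume "y \<in> carrier ?T"
  then obtain d t where y: "y = fraction R d t" "d \<in> carrier R" "t \<in> regular_elements R"
    by (rule total_quotient_cases)
  show "a \<odot>\<^bsub>?T\<^esub> (x \<oplus>\<^bsub>?T\<^esub> y) = a \<odot>\<^bsub>?T\<^esub> x \<oplus>\<^bsub>?T\<^esub> a \<odot>\<^bsub>?T\<^esub> y"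
    using a x y by (simp add: simps r_distr m_assoc)
qed

lemma to_total_quotient_hom:
  "to_total_quotient R \<in> ring_hom R (total_quotient_ring R)"
  by (rule ring_hom_memI)
    (simp_all add: to_total_quotient_def total_quotient_simps(2,3) fraction_mult fraction_add)

lemma inj_to_total_quotient: "inj_on (to_total_quotient R) (carrier R)"
  by (rule inj_onI) (simp add: to_total_quotient_def fraction_eq_iff)

end


section \<open>Invertible ideals, radical ideals, and ISP-rings\<close>

text \<open>
  The equation \<open>J J' = R\<close> lives in the total quotient ring, in which \<open>J\<close> and \<open>R\<close> are replaced
  by their images. Although named for ideals, \<open>ideal_prod\<close> is the set of finite sums of
  products for arbitrary sets.
\<close>

definition invertible_ideal :: "('a, 'm) ring_scheme \<Rightarrow> 'a set \<Rightarrow> bool"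
  where "invertible_ideal R J \<longleftrightarrow> ideal J R \<and>
    (\<exists>J'. submodule J' R (total_quotient_ring R) \<and>
      ideal_prod (total_quotient_ring R) (to_total_quotient R ` J) J'
        = to_total_quotient R ` carrier R)"

definition radical :: "('a, 'm) ring_scheme \<Rightarrow> 'a set \<Rightarrow> 'a set"
  where "radical R I = {a \<in> carrier R. \<exists>n::nat. n \<ge> 1 \<and> a [^]\<^bsub>R\<^esub> n \<in> I}"

definition proper_radical_ideal :: "('a, 'm) ring_scheme \<Rightarrow> 'a set \<Rightarrow> bool"
  where "proper_radical_ideal R H \<longleftrightarrow> ideal H R \<and> H \<noteq> carrier R \<and> radical R H = H"

text \<open>\<open>I = J H\<^sub>1 \<cdots> H\<^sub>n\<close> with \<open>n \<ge> 1\<close>; the list \<open>Hs\<close> is \<open>H\<^sub>1, \<dots>, H\<^sub>n\<close>.\<close>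

definition ISP_factorable :: "('a, 'm) ring_scheme \<Rightarrow> 'a set \<Rightarrow> bool"
  where "ISP_factorable R I \<longleftrightarrow>
    (\<exists>J Hs. invertible_ideal R J \<and> Hs \<noteq> [] \<and> (\<forall>H \<in> set Hs. proper_radical_ideal R H) \<and>
      I = foldl (ideal_prod R) J Hs)"

definition ISP_ring :: "('a, 'm) ring_scheme \<Rightarrow> bool"
  where "ISP_ring R \<longleftrightarrow> cring R \<and> \<one>\<^bsub>R\<^esub> \<noteq> \<zero>\<^bsub>R\<^esub> \<and>
    (\<forall>I. regular_ideal R I \<and> I \<noteq> carrier R \<longrightarrow> ISP_factorable R I)"

end

theory Submission
  imports Defs
begin

text \<open>
  An element \<open>(a, e)\<close> of the extension is regular iff \<open>a \<in> S\<close>. As \<open>(s, e) (0, f) = (0, s f)\<close>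
  and \<open>s E = E\<close> for \<open>s \<in> S\<close>, every regular ideal contains \<open>0 \<times> E\<close>, so the regular ideals are
  exactly the \<open>I \<times> E\<close> with \<open>I\<close> an ideal of \<open>A\<close> that meets \<open>S\<close>. This correspondence respects
  products (as \<open>I E = E\<close>) and radical ideals. It respects invertibility because an ideal \<open>J\<close> that
  contains a regular element \<open>s\<close> is invertible iff \<open>J K = (s)\<close> for some ideal \<open>K\<close>, a condition
  that does not mention the total quotient ring. Finally, a product lies in each of its
  factors, so every factor of a regular ideal is regular.
\<close>

section \<open>Products and invertibility\<close>

lemma (in cring) ideal_criterion:
  assumes "I \<subseteq> carrier R" "\<zero> \<in> I"
    and add: "\<And>a b. a \<in> I \<Longrightarrow> b \<in> I \<Longrightarrow> a \<oplus> b \<in> I"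
    and mult: "\<And>a x. a \<in> I \<Longrightarrow> x \<in> carrier R \<Longrightarrow> x \<otimes> a \<in> I"
  shows "ideal I R"
proof (rule idealI)
  have "\<ominus> a \<in> I" if "a \<in> I" for a
    using mult[OF that, of "\<ominus> \<one>"] that assms(1) by (simp add: subset_iff l_minus)
  then show "subgroup I (add_monoid R)"
    using assms by (intro add.subgroupI) (auto simp: a_inv_def)
  fix a x assume "a \<in> I" "x \<in> carrier R"
  then show "x \<otimes> a \<in> I" "a \<otimes> x \<in> I"
    using mult[of a x] m_comm[of a x] assms(1) by auto
qed (rule ring_axioms)

text \<open>Induction on the generation of \<open>ideal_prod\<close>. None of the sets has to be an
  ideal, so the rule also covers products in the total quotient ring, where the factors are images
  of ideals or submodules.\<close>

lemma ideal_prod_subset: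
  assumes "\<And>i j. i \<in> I \<Longrightarrow> j \<in> J \<Longrightarrow> i \<otimes>\<^bsub>R\<^esub> j \<in> K"
    and "\<And>a b. a \<in> K \<Longrightarrow> b \<in> K \<Longrightarrow> a \<oplus>\<^bsub>R\<^esub> b \<in> K"
  shows "ideal_prod R I J \<subseteq> K"
proof
  fix x assume "x \<in> ideal_prod R I J"
  then show "x \<in> K" by induction (use assms in auto)
qed

text \<open>The induction removes the last factor, which \<open>foldl\<close> multiplies on at the
  end. The two containments serve to show that the factors of a regular ideal are regular.\<close>

lemma (in ring) foldl_ideal_prod:
  assumes "ideal J R" "\<forall>H \<in> set Hs. ideal H R"
  shows "ideal (foldl (ideal_prod R) J Hs) R \<and> foldl (ideal_prod R) J Hs \<subseteq> J \<and>
    (\<forall>H \<in> set Hs. foldl (ideal_prod R) J Hs \<subseteq> H)"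
  using assms
proof (induction Hs rule: rev_induct)
  case (snoc H Hs)
  let ?P = "foldl (ideal_prod R) J Hs"
  have "ideal ?P R" "ideal H R" using snoc by auto
  then have "ideal (ideal_prod R ?P H) R" "ideal_prod R ?P H \<subseteq> ?P" "ideal_prod R ?P H \<subseteq> H"
    using ideal_prod_is_ideal ideal_prod_inter by blast+
  with snoc show ?case by simp blast
qed simp

context cring
begin

section \<open>Fractions over a fixed denominator, and invertibility\<close>

lemma fraction_add_same_denominator:
  assumes "a \<in> carrier R" "b \<in> carrier R" "s \<in> regular_elements R"
  shows "fraction R a s \<oplus>\<^bsub>total_quotient_ring R\<^esub> fraction R b s = fraction R (a \<oplus> b) s"
proof -
  have "fraction R (a \<otimes> s \<oplus> b \<otimes> s) (s \<otimes> s) = fraction R (a \<oplus> b) s"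
    using assms by (intro fraction_eqI) (simp_all add: l_distr r_distr m_ac)
  with assms show ?thesis by (simp add: fraction_add)
qed

lemma to_total_quotient_mult_fraction:
  assumes "a \<in> carrier R" "b \<in> carrier R" "s \<in> regular_elements R"
  shows "to_total_quotient R a \<otimes>\<^bsub>total_quotient_ring R\<^esub> fraction R b s = fraction R (a \<otimes> b) s"
  using assms by (simp add: to_total_quotient_def fraction_mult)

text \<open>The fraction \<open>a / s\<close> equals \<open>c / 1\<close> iff
  \<open>a = c \<otimes> s\<close>, so lying in the base ring becomes membership in a principal
  ideal.\<close>

lemma fraction_in_image_iff:
  assumes "a \<in> carrier R" "s \<in> regular_elements R"
  shows "fraction R a s \<in> to_total_quotient R ` carrier R \<longleftrightarrow> a \<in> PIdl s"
  using assms by (auto simp: to_total_quotient_def image_iff fraction_eq_iff cgenideal_def)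

text \<open>Take \<open>K = s J'\<close>, encoded as the set \<open>?K\<close> of numerators
  \<open>b\<close> with \<open>b / s\<close> in \<open>J'\<close>. It accounts for all of
  \<open>s J'\<close>, because \<open>s \<in> J\<close> and \<open>J J' = R\<close> put
  \<open>s J'\<close> inside the ring. Multiplying \<open>J J' = R\<close> by \<open>s\<close> gives
  \<open>J K = (s)\<close>.\<close>

lemma invertible_ideal_imp_prod_principal:
  assumes J: "ideal J R" and s: "s \<in> J" "s \<in> regular_elements R"
    and J': "submodule J' R (total_quotient_ring R)"
    and eq: "ideal_prod (total_quotient_ring R) (to_total_quotient R ` J) J'
      = to_total_quotient R ` carrier R"
  shows "\<exists>K. ideal K R \<and> ideal_prod R J K = PIdl s"
proof (intro exI conjI)
  let ?T = "total_quotient_ring R"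
  let ?K = "{b \<in> carrier R. fraction R b s \<in> J'}"
  interpret J: ideal J R by (rule J)
  interpret T: module R ?T by (rule module_total_quotient_ring)
  note J'E = T.submoduleE[OF J']
  have s_carr: "s \<in> carrier R" using s by simp
  have prod: "to_total_quotient R a \<otimes>\<^bsub>?T\<^esub> y \<in> to_total_quotient R ` carrier R"
    if "a \<in> J" "y \<in> J'" for a y
    using ideal_prod.prod[of "to_total_quotient R a" "to_total_quotient R ` J" y J' ?T] that eq
    by blast
  \<comment> \<open>Nonemptiness of \<open>J'\<close> yields some \<open>y = c / t\<close>. Scaling
    it by \<open>\<zero>\<close> gives \<open>\<zero> / t\<close>, which is the same fraction as
    \<open>\<zero> / s\<close>.\<close>
  obtain y where y: "y \<in> J'" using J'E(2) by blast
  have "y \<in> carrier ?T" using y J'E(1) by blast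
  then obtain c t where "y = fraction R c t" "c \<in> carrier R" "t \<in> regular_elements R"
    by (rule total_quotient_cases)
  then have "\<zero> \<odot>\<^bsub>?T\<^esub> y = fraction R \<zero> t" by (simp add: fraction_smult)
  also have "\<dots> = fraction R \<zero> s"
    using s_carr s(2) \<open>t \<in> _\<close> by (intro fraction_eqI) simp_all
  finally have zero: "fraction R \<zero> s \<in> J'" using J'E(4)[OF zero_closed y] by simp
  show K: "ideal ?K R"
  proof (rule ideal_criterion)
    fix a b assume "a \<in> ?K" "b \<in> ?K"
    then show "a \<oplus> b \<in> ?K"
      using J'E(5)[of "fraction R a s" "fraction R b s"] s
      by (simp add: fraction_add_same_denominator)
  next
    fix a x assume "a \<in> ?K" "x \<in> carrier R"
    then show "x \<otimes> a \<in> ?K"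
      using J'E(4)[of x "fraction R a s"] s by (simp add: fraction_smult)
  qed (use zero in auto)
  interpret JK: ideal "ideal_prod R J ?K" R by (rule ideal_prod_is_ideal[OF J K])
  interpret P: ideal "PIdl s" R by (rule cgenideal_ideal[OF s_carr])
  show "ideal_prod R J ?K = PIdl s"
  proof
    show "ideal_prod R J ?K \<subseteq> PIdl s"
    proof (rule ideal_prod_subset)
      fix a b assume ab: "a \<in> J" "b \<in> ?K"
      then have "fraction R (a \<otimes> b) s \<in> to_total_quotient R ` carrier R"
        using prod[of a "fraction R b s"] s by (simp add: to_total_quotient_mult_fraction J.Icarr)
      then show "a \<otimes> b \<in> PIdl s"
        using ab s by (simp add: fraction_in_image_iff J.Icarr)
    qed (rule P.a_closed)
  next
    \<comment> \<open>Every element of \<open>J J'\<close> has the form \<open>b / s\<close> with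
      \<open>b\<close> in \<open>J K\<close>. Since \<open>J J' = R\<close> contains
      \<open>\<one>\<close>, some such \<open>b / s\<close> equals \<open>\<one>\<close>, which
      forces \<open>s = b\<close> and hence \<open>s\<close> in \<open>J K\<close>.\<close>
    have "ideal_prod ?T (to_total_quotient R ` J) J'
        \<subseteq> {fraction R b s | b. b \<in> ideal_prod R J ?K}"
    proof (rule ideal_prod_subset)
      fix x y assume x: "x \<in> to_total_quotient R ` J" and y: "y \<in> J'"
      from x obtain a where a: "x = to_total_quotient R a" "a \<in> J" by blast
      have "y \<in> carrier ?T" using y J'E(1) by blast
      then obtain c t where c: "y = fraction R c t" "c \<in> carrier R" "t \<in> regular_elements R"
        by (rule total_quotient_cases)
      \<comment> \<open>Because \<open>s \<in> J\<close>, the product of \<open>s\<close> and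
        \<open>y\<close> lies in the ring; call it \<open>d\<close>. Then \<open>y = d / s\<close>,
        so every element of \<open>J'\<close> can be written with denominator
        \<open>s\<close>.\<close>
      have "fraction R (s \<otimes> c) t \<in> to_total_quotient R ` carrier R"
        using prod[OF s(1) y] c s_carr by (simp add: to_total_quotient_mult_fraction)
      then have "s \<otimes> c \<in> PIdl t" using c(2,3) s_carr by (simp add: fraction_in_image_iff)
      then obtain d where d: "d \<in> carrier R" "s \<otimes> c = d \<otimes> t"
        unfolding cgenideal_def by blast
      have "c \<otimes> s = d \<otimes> t" using c(2) s_carr d(2) by (simp only: m_comm)
      then have yd: "y = fraction R d s"
        unfolding c(1) using c(2,3) d(1) s(2) by (intro fraction_eqI)
      then have "a \<otimes> d \<in> ideal_prod R J ?K"
        using a d y by (intro ideal_prod.prod) auto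
      moreover have "x \<otimes>\<^bsub>?T\<^esub> y = fraction R (a \<otimes> d) s"
        unfolding a(1) yd using a d s by (simp add: to_total_quotient_mult_fraction J.Icarr)
      ultimately show "x \<otimes>\<^bsub>?T\<^esub> y \<in> {fraction R b s | b. b \<in> ideal_prod R J ?K}" by blast
    next
      fix x y assume xy: "x \<in> {fraction R b s | b. b \<in> ideal_prod R J ?K}"
        "y \<in> {fraction R b s | b. b \<in> ideal_prod R J ?K}"
      from xy(1) obtain b where b: "x = fraction R b s" "b \<in> ideal_prod R J ?K"
        by (elim CollectE exE conjE)
      from xy(2) obtain c where c: "y = fraction R c s" "c \<in> ideal_prod R J ?K"
        by (elim CollectE exE conjE)
      have "x \<oplus>\<^bsub>?T\<^esub> y = fraction R (b \<oplus> c) s"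
        unfolding b(1) c(1) using b(2) c(2) s(2)
        by (intro fraction_add_same_denominator JK.Icarr)
      with JK.a_closed[OF b(2) c(2)]
      show "x \<oplus>\<^bsub>?T\<^esub> y \<in> {fraction R b s | b. b \<in> ideal_prod R J ?K}" by blast
    qed
    moreover have "fraction R \<one> \<one> \<in> to_total_quotient R ` carrier R"
      by (auto simp: to_total_quotient_def)
    ultimately have "fraction R \<one> \<one> \<in> {fraction R b s | b. b \<in> ideal_prod R J ?K}"
      unfolding eq by (rule subsetD)
    then obtain b where b: "fraction R \<one> \<one> = fraction R b s" "b \<in> ideal_prod R J ?K"
      by (elim CollectE exE conjE)
    have "b \<in> carrier R" using b(2) by (rule JK.Icarr)
    then have "s = b" using b(1) s(2) s_carr by (simp add: fraction_eq_iff)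
    with b(2) have "s \<in> ideal_prod R J ?K" by (simp only:)
    then show "PIdl s \<subseteq> ideal_prod R J ?K" by (rule cgenideal_minimal[OF JK.ideal_axioms])
  qed
qed

text \<open>The module inverse to \<open>J\<close> is \<open>K / s\<close>, since
  \<open>J (K / s) = (s) / s = R\<close>.\<close>

lemma prod_principal_imp_invertible_ideal:
  assumes J: "ideal J R" and s: "s \<in> regular_elements R"
    and K: "ideal K R" and eq: "ideal_prod R J K = PIdl s"
  shows "invertible_ideal R J"
  unfolding invertible_ideal_def
proof (intro conjI exI)
  let ?T = "total_quotient_ring R"
  let ?F = "{fraction R b s | b. b \<in> K}"
  interpret J: ideal J R by (rule J)
  interpret K: ideal K R by (rule K)
  interpret T: module R ?T by (rule module_total_quotient_ring)
  have s_carr: "s \<in> carrier R" using s by simp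
  have smult: "a \<odot>\<^bsub>?T\<^esub> x \<in> ?F" if a: "a \<in> carrier R" and x: "x \<in> ?F" for a x
  proof -
    obtain b where "x = fraction R b s" "b \<in> K" using x by blast
    then show ?thesis
      using a s K.I_l_closed by (auto simp: fraction_smult K.Icarr)
  qed
  have carr: "?F \<subseteq> carrier ?T" using s by (auto simp: K.Icarr)
  show "submodule ?F R ?T"
  proof (rule T.submoduleI)
    show "\<zero>\<^bsub>?T\<^esub> \<in> ?F"
      using s s_carr K.zero_closed fraction_eq_iff[of \<zero> \<one> \<zero> s]
      by (auto simp: total_quotient_simps)
    fix x assume x: "x \<in> ?F"
    then have "\<ominus>\<^bsub>?T\<^esub> x = (\<ominus> \<one>) \<odot>\<^bsub>?T\<^esub> x" using carr T.smult_l_minus[of \<one> x] by auto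
    with x show "\<ominus>\<^bsub>?T\<^esub> x \<in> ?F" using smult[of "\<ominus> \<one>" x] by simp
  next
    fix x y assume "x \<in> ?F" "y \<in> ?F"
    then obtain b c where "x = fraction R b s" "y = fraction R c s" "b \<in> K" "c \<in> K" by blast
    then show "x \<oplus>\<^bsub>?T\<^esub> y \<in> ?F"
      using s K.a_closed by (auto simp: fraction_add_same_denominator K.Icarr)
  qed (use carr smult in auto)
  show "ideal_prod ?T (to_total_quotient R ` J) ?F = to_total_quotient R ` carrier R"
  proof
    show "ideal_prod ?T (to_total_quotient R ` J) ?F \<subseteq> to_total_quotient R ` carrier R"
    proof (rule ideal_prod_subset)
      fix x y assume "x \<in> to_total_quotient R ` J" "y \<in> ?F"
      then obtain a b where ab: "x = to_total_quotient R a" "y = fraction R b s" "a \<in> J" "b \<in> K"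
        by blast
      then have "a \<otimes> b \<in> PIdl s" unfolding eq[symmetric] by (intro ideal_prod.prod)
      then show "x \<otimes>\<^bsub>?T\<^esub> y \<in> to_total_quotient R ` carrier R"
        using ab s by (simp add: to_total_quotient_mult_fraction fraction_in_image_iff J.Icarr K.Icarr)
    next
      fix x y assume "x \<in> to_total_quotient R ` carrier R" "y \<in> to_total_quotient R ` carrier R"
      then show "x \<oplus>\<^bsub>?T\<^esub> y \<in> to_total_quotient R ` carrier R"
        using ring_hom_add[OF to_total_quotient_hom, symmetric] by auto
    qed
    \<comment> \<open>The \<open>x\<close> with \<open>x / s\<close> in \<open>J (K / s)\<close>
      contain all products from \<open>J\<close> and \<open>K\<close> and are closed under sums, so
      they include all of \<open>J K = (s)\<close>. Applied to \<open>c \<otimes> s\<close>, whose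
      fraction over \<open>s\<close> is \<open>c / 1\<close>, this yields every element of the
      ring.\<close>
    have "ideal_prod R J K
        \<subseteq> {x \<in> carrier R. fraction R x s \<in> ideal_prod ?T (to_total_quotient R ` J) ?F}"
    proof (rule ideal_prod_subset)
      fix a b assume ab: "a \<in> J" "b \<in> K"
      have "to_total_quotient R a \<otimes>\<^bsub>?T\<^esub> fraction R b s
          \<in> ideal_prod ?T (to_total_quotient R ` J) ?F"
        using ab by (intro ideal_prod.prod) auto
      then show "a \<otimes> b \<in> {x \<in> carrier R.
          fraction R x s \<in> ideal_prod ?T (to_total_quotient R ` J) ?F}"
        using ab s by (simp add: to_total_quotient_mult_fraction J.Icarr K.Icarr)
    next
      fix a b assume
        "a \<in> {x \<in> carrier R. fraction R x s \<in> ideal_prod ?T (to_total_quotient R ` J) ?F}"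
        "b \<in> {x \<in> carrier R. fraction R x s \<in> ideal_prod ?T (to_total_quotient R ` J) ?F}"
      then show "a \<oplus> b
          \<in> {x \<in> carrier R. fraction R x s \<in> ideal_prod ?T (to_total_quotient R ` J) ?F}"
        using s by (auto simp: fraction_add_same_denominator[symmetric] intro: ideal_prod.sum)
    qed
    moreover have "to_total_quotient R c = fraction R (c \<otimes> s) s" "c \<otimes> s \<in> PIdl s"
      if "c \<in> carrier R" for c
      using that s s_carr by (auto simp: to_total_quotient_def fraction_eq_iff cgenideal_def)
    ultimately show "to_total_quotient R ` carrier R
        \<subseteq> ideal_prod ?T (to_total_quotient R ` J) ?F"
      unfolding eq by auto
  qed
qed (rule J)

lemma invertible_ideal_iff_prod_principal:
  assumes "ideal J R" "s \<in> J" "s \<in> regular_elements R"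
  shows "invertible_ideal R J \<longleftrightarrow> (\<exists>K. ideal K R \<and> ideal_prod R J K = PIdl s)"
  using invertible_ideal_imp_prod_principal[OF assms]
    prod_principal_imp_invertible_ideal[OF assms(1,3)]
  unfolding invertible_ideal_def by blast

end


section \<open>Regular ideals of the trivial extension\<close>

lemma trivial_extension_simps:
  "carrier (trivial_extension R M) = carrier R \<times> carrier M"
  "(a, e) \<otimes>\<^bsub>trivial_extension R M\<^esub> (b, f)
    = (a \<otimes>\<^bsub>R\<^esub> b, a \<odot>\<^bsub>M\<^esub> f \<oplus>\<^bsub>M\<^esub> b \<odot>\<^bsub>M\<^esub> e)"
  "\<one>\<^bsub>trivial_extension R M\<^esub> = (\<one>\<^bsub>R\<^esub>, \<zero>\<^bsub>M\<^esub>)"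
  "\<zero>\<^bsub>trivial_extension R M\<^esub> = (\<zero>\<^bsub>R\<^esub>, \<zero>\<^bsub>M\<^esub>)"
  "(a, e) \<oplus>\<^bsub>trivial_extension R M\<^esub> (b, f) = (a \<oplus>\<^bsub>R\<^esub> b, e \<oplus>\<^bsub>M\<^esub> f)"
  by (simp_all add: trivial_extension_def)

text \<open>If \<open>a f = 0\<close> with \<open>f \<noteq> 0\<close> in the module, then
  \<open>(a, e)\<close> annihilates \<open>(0, f)\<close>. If \<open>a b = 0\<close> with
  \<open>b \<noteq> 0\<close> in the ring, it annihilates \<open>(b, 0)\<close> when
  \<open>b e = 0\<close>, and \<open>(0, b e)\<close> otherwise. Conversely,
  \<open>(a, e) (b, f) = 0\<close> gives \<open>a b = 0\<close>, and in the case
  \<open>b = 0\<close> it leaves \<open>a f = 0\<close> with \<open>f \<noteq> 0\<close>.\<close>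

lemma (in module) regular_trivial_extension_iff:
  "(a, e) \<in> regular_elements (trivial_extension R M) \<longleftrightarrow>
    e \<in> carrier M \<and> a \<in> carrier R - (zero_divisors R \<union> zero_divisors_on R M)"
proof (cases "a \<in> carrier R \<and> e \<in> carrier M")
  case True
  then have a: "a \<in> carrier R" and e: "e \<in> carrier M" by auto
  have zero_divisorI: "(a, e) \<in> zero_divisors (trivial_extension R M)"
    if "b \<in> carrier R" "f \<in> carrier M" "(b, f) \<noteq> (\<zero>, \<zero>\<^bsub>M\<^esub>)"
      "a \<otimes> b = \<zero>" "a \<odot>\<^bsub>M\<^esub> f \<oplus>\<^bsub>M\<^esub> b \<odot>\<^bsub>M\<^esub> e = \<zero>\<^bsub>M\<^esub>" for b f
    unfolding zero_divisors_def trivial_extension_simps(1)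
    by (rule CollectI, rule conjI, use a e in simp, rule bexI[of _ "(b, f)"])
      (use that in \<open>simp_all add: trivial_extension_simps\<close>)
  have "(a, e) \<in> zero_divisors (trivial_extension R M)" if z: "a \<in> zero_divisors_on R M"
  proof -
    obtain f where "f \<in> carrier M" "f \<noteq> \<zero>\<^bsub>M\<^esub>" "a \<odot>\<^bsub>M\<^esub> f = \<zero>\<^bsub>M\<^esub>"
      using z by (auto simp: zero_divisors_on_def)
    then show ?thesis using a e by (intro zero_divisorI[of \<zero> f]) simp_all
  qed
  moreover have "(a, e) \<in> zero_divisors (trivial_extension R M)"
    if z: "a \<in> zero_divisors R"
  proof -
    obtain b where b: "b \<in> carrier R" "b \<noteq> \<zero>" "a \<otimes> b = \<zero>"
      using z by (auto simp: zero_divisors_def)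
    show ?thesis
    proof (cases "b \<odot>\<^bsub>M\<^esub> e = \<zero>\<^bsub>M\<^esub>")
      case True
      then show ?thesis using a b by (intro zero_divisorI[of b "\<zero>\<^bsub>M\<^esub>"]) simp_all
    next
      case False
      have "a \<odot>\<^bsub>M\<^esub> (b \<odot>\<^bsub>M\<^esub> e) = \<zero>\<^bsub>M\<^esub>"
        using a b e by (simp flip: smult_assoc1)
      with False show ?thesis
        using a b e by (intro zero_divisorI[of \<zero> "b \<odot>\<^bsub>M\<^esub> e"]) simp_all
    qed
  qed
  moreover have "a \<in> zero_divisors R \<union> zero_divisors_on R M"
    if z: "(a, e) \<in> zero_divisors (trivial_extension R M)"
  proof -
    obtain b f where bf: "b \<in> carrier R" "f \<in> carrier M" "(b, f) \<noteq> (\<zero>, \<zero>\<^bsub>M\<^esub>)"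
      "a \<otimes> b = \<zero>" "a \<odot>\<^bsub>M\<^esub> f \<oplus>\<^bsub>M\<^esub> b \<odot>\<^bsub>M\<^esub> e = \<zero>\<^bsub>M\<^esub>"
      using z by (auto simp: zero_divisors_def trivial_extension_simps)
    show ?thesis
    proof (cases "b = \<zero>")
      case True
      with bf a e show ?thesis by (auto simp: zero_divisors_on_def)
    next
      case False
      with bf a show ?thesis by (auto simp: zero_divisors_def)
    qed
  qed
  ultimately show ?thesis
    using a e by (auto simp: regular_elements_def trivial_extension_simps)
qed (auto simp: regular_elements_def trivial_extension_simps)

section \<open>Regular ideals of the extension as products
  \<open>I \<times> carrier M\<close>\<close>

locale trivial_extension_divisible = module +
  fixes S
  defines "S \<equiv> carrier R - (zero_divisors R \<union> zero_divisors_on R M)"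
  assumes divisible: "s \<in> S \<Longrightarrow> carrier M = (\<lambda>e. s \<odot>\<^bsub>M\<^esub> e) ` carrier M"
begin

abbreviation T where "T \<equiv> trivial_extension R M"

sublocale T: cring T by (rule cring_trivial_extension)

lemma regular_T_iff: "(a, e) \<in> regular_elements T \<longleftrightarrow> e \<in> carrier M \<and> a \<in> S"
  unfolding S_def by (rule regular_trivial_extension_iff)

lemma S_regular: "s \<in> S \<Longrightarrow> s \<in> regular_elements R"
  by (simp add: S_def regular_elements_def)

text \<open>\<open>S\<close> consists of the first components of the regular elements of
  \<open>T\<close>, and regular elements of any commutative ring are closed under products.\<close>

lemma S_mult:
  assumes "s \<in> S" "t \<in> S"
  shows "s \<otimes> t \<in> S"
  using T.regular_mult[of "(s, \<zero>\<^bsub>M\<^esub>)" "(t, \<zero>\<^bsub>M\<^esub>)"] assms S_regular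
  by (simp add: regular_T_iff trivial_extension_simps)

lemma ideal_times:
  assumes "ideal I R"
  shows "ideal (I \<times> carrier M) T"
proof -
  interpret I: ideal I R by (rule assms)
  show ?thesis
    by (rule T.ideal_criterion)
      (auto simp: trivial_extension_simps I.I_l_closed I.a_closed I.Icarr)
qed

lemma meets_times_iff:
  "(I \<times> carrier M) \<inter> regular_elements T \<noteq> {} \<longleftrightarrow> I \<inter> S \<noteq> {}"
proof -
  have "p \<in> regular_elements T \<longleftrightarrow> fst p \<in> S \<and> snd p \<in> carrier M" for p
    using regular_T_iff[of "fst p" "snd p"] by auto
  then have "(I \<times> carrier M) \<inter> regular_elements T = (I \<inter> S) \<times> carrier M" by auto
  then show ?thesis using M.zero_closed by auto
qed

lemma times_eq_iff [simp]: "I \<times> carrier M = K \<times> carrier M \<longleftrightarrow> I = K"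
  using M.zero_closed by blast

text \<open>The ideal \<open>I\<close> is the first projection of \<open>P\<close>. As
  \<open>P\<close> contains every \<open>(\<zero>, e)\<close>, the second component of a member of
  \<open>P\<close> can be changed freely by addition.\<close>

lemma regular_ideal_T_cases:
  assumes "ideal P T" "P \<inter> regular_elements T \<noteq> {}"
  obtains I where "P = I \<times> carrier M" "ideal I R" "I \<inter> S \<noteq> {}"
proof
  let ?I = "fst ` P"
  interpret P: ideal P T by (rule assms)
  have carr: "a \<in> carrier R" "e \<in> carrier M" if "(a, e) \<in> P" for a e
    using P.Icarr[OF that] by (auto simp: trivial_extension_simps)
  obtain s g where s: "(s, g) \<in> P" "g \<in> carrier M" "s \<in> S"
    using assms(2) by (auto simp: regular_T_iff)
  \<comment> \<open>Writing \<open>e = s f\<close> exhibits \<open>(\<zero>, e)\<close> as the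
    product of \<open>(s, g)\<close> and \<open>(\<zero>, f)\<close>; the unknown \<open>g\<close>
    vanishes because it is multiplied by \<open>\<zero>\<close>.\<close>
  have vert: "(\<zero>, e) \<in> P" if "e \<in> carrier M" for e
  proof -
    obtain f where f: "f \<in> carrier M" "e = s \<odot>\<^bsub>M\<^esub> f" using divisible[OF s(3)] \<open>e \<in> _\<close> by blast
    have "(s, g) \<otimes>\<^bsub>T\<^esub> (\<zero>, f) = (\<zero>, e)"
      using f carr[OF s(1)] by (simp add: trivial_extension_simps)
    then show ?thesis
      using P.I_r_closed[OF s(1), of "(\<zero>, f)"] f by (simp add: trivial_extension_simps)
  qed
  show eq: "P = ?I \<times> carrier M"
  proof
    show "?I \<times> carrier M \<subseteq> P"
    proof clarsimp
      fix a e f assume h: "e \<in> carrier M" "(a, f) \<in> P"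
      have "(a, f) \<oplus>\<^bsub>T\<^esub> (\<zero>, e \<ominus>\<^bsub>M\<^esub> f) = (a, e)"
        using h carr[OF h(2)]
        by (simp add: trivial_extension_simps M.minus_eq M.a_comm[of f] M.a_assoc M.l_neg)
      then show "(a, e) \<in> P"
        using P.a_closed[OF h(2) vert[of "e \<ominus>\<^bsub>M\<^esub> f"]] h carr[OF h(2)] by simp
    qed
  qed (use carr in \<open>auto intro: rev_image_eqI\<close>)
  show "?I \<inter> S \<noteq> {}" using s by force
  show "ideal ?I R"
  proof (rule R.ideal_criterion)
    show "?I \<subseteq> carrier R" using carr by auto
    show "\<zero> \<in> ?I" using vert[of "\<zero>\<^bsub>M\<^esub>"] by force
    fix a assume "a \<in> ?I"
    then obtain e where e: "(a, e) \<in> P" by auto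
    {
      fix b assume "b \<in> ?I"
      then obtain f where "(b, f) \<in> P" by auto
      then show "a \<oplus> b \<in> ?I"
        using P.a_closed[OF e] by (force simp: trivial_extension_simps)
    }
    fix x assume "x \<in> carrier R"
    then show "x \<otimes> a \<in> ?I"
      using P.I_l_closed[OF e, of "(x, \<zero>\<^bsub>M\<^esub>)"] by (force simp: trivial_extension_simps)
  qed
qed

lemma ideal_prod_meets:
  assumes "I \<inter> S \<noteq> {}" "K \<inter> S \<noteq> {}"
  shows "ideal_prod R I K \<inter> S \<noteq> {}"
  using assms S_mult ideal_prod.prod[of _ I _ K R] by blast

text \<open>The product in \<open>T\<close> contains \<open>(s \<otimes> t, \<zero>)\<close> with
  \<open>s\<close> and \<open>t\<close> in \<open>S\<close>, so it is regular and has the form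
  \<open>L \<times> carrier M\<close>. For the inclusion from right to left it therefore suffices to
  reach each first component with second component zero.\<close>

lemma ideal_prod_times:
  assumes I: "ideal I R" "I \<inter> S \<noteq> {}" and K: "ideal K R" "K \<inter> S \<noteq> {}"
  shows "ideal_prod T (I \<times> carrier M) (K \<times> carrier M) = ideal_prod R I K \<times> carrier M"
proof
  interpret I: ideal I R by (rule I)
  interpret K: ideal K R by (rule K)
  let ?P = "ideal_prod T (I \<times> carrier M) (K \<times> carrier M)"
  show "?P \<subseteq> ideal_prod R I K \<times> carrier M"
    by (rule ideal_prod_subset)
      (auto simp: trivial_extension_simps I.Icarr K.Icarr intro: ideal_prod.intros)
  obtain s t where st: "s \<in> I" "s \<in> S" "t \<in> K" "t \<in> S" using I K by blast
  have P: "ideal ?P T" using I K by (intro T.ideal_prod_is_ideal ideal_times)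
  have "(s \<otimes> t, \<zero>\<^bsub>M\<^esub>) \<in> ?P"
    using ideal_prod.prod[of "(s, \<zero>\<^bsub>M\<^esub>)" "I \<times> carrier M" "(t, \<zero>\<^bsub>M\<^esub>)" "K \<times> carrier M" T] st
    by (simp add: trivial_extension_simps I.Icarr K.Icarr)
  then have "?P \<inter> regular_elements T \<noteq> {}"
    using st S_mult by (auto simp: regular_T_iff)
  with P obtain L where L: "?P = L \<times> carrier M" by (rule regular_ideal_T_cases)
  have "ideal_prod R I K \<subseteq> {a. (a, \<zero>\<^bsub>M\<^esub>) \<in> ?P}"
  proof (rule ideal_prod_subset)
    fix a b assume "a \<in> I" "b \<in> K"
    then show "a \<otimes> b \<in> {a. (a, \<zero>\<^bsub>M\<^esub>) \<in> ?P}"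
      using ideal_prod.prod[of "(a, \<zero>\<^bsub>M\<^esub>)" "I \<times> carrier M" "(b, \<zero>\<^bsub>M\<^esub>)" "K \<times> carrier M" T]
      by (simp add: trivial_extension_simps I.Icarr K.Icarr)
  next
    fix a b assume "a \<in> {a. (a, \<zero>\<^bsub>M\<^esub>) \<in> ?P}" "b \<in> {a. (a, \<zero>\<^bsub>M\<^esub>) \<in> ?P}"
    then show "a \<oplus> b \<in> {a. (a, \<zero>\<^bsub>M\<^esub>) \<in> ?P}"
      using ideal_prod.sum[of "(a, \<zero>\<^bsub>M\<^esub>)" T _ _ "(b, \<zero>\<^bsub>M\<^esub>)"]
      by (simp add: trivial_extension_simps)
  qed
  then show "ideal_prod R I K \<times> carrier M \<subseteq> ?P" unfolding L by auto
qed

text \<open>\<open>J\<close> is arbitrary in the induction because the partial product of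
  \<open>J\<close> and \<open>H\<close> takes its place; that product is again an ideal meeting
  \<open>S\<close>.\<close>

lemma foldl_ideal_prod_times:
  assumes "ideal J R" "J \<inter> S \<noteq> {}" "\<forall>H \<in> set Hs. ideal H R \<and> H \<inter> S \<noteq> {}"
  shows "foldl (ideal_prod T) (J \<times> carrier M) (map (\<lambda>H. H \<times> carrier M) Hs)
    = foldl (ideal_prod R) J Hs \<times> carrier M"
  using assms
proof (induction Hs arbitrary: J)
  case (Cons H Hs)
  then have "ideal (ideal_prod R J H) R" "ideal_prod R J H \<inter> S \<noteq> {}"
    using R.ideal_prod_is_ideal ideal_prod_meets by simp_all
  with Cons show ?case by (simp add: ideal_prod_times)
qed simp

section \<open>Radical, principal and invertible ideals under the correspondence\<close>

lemma fst_pow_T: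
  assumes "p \<in> carrier T"
  shows "fst (p [^]\<^bsub>T\<^esub> (n::nat)) = fst p [^] n"
proof (induction n)
  case (Suc n)
  have "fst (x \<otimes>\<^bsub>T\<^esub> y) = fst x \<otimes> fst y" for x y
    by (cases x; cases y) (simp add: trivial_extension_simps)
  with Suc show ?case by simp
qed (simp add: trivial_extension_simps)

text \<open>Whether a power lies in \<open>H \<times> carrier M\<close> depends on its first
  component alone, and the first projection respects powers. So taking radicals commutes with
  forming the product with \<open>carrier M\<close>.\<close>

lemma proper_radical_ideal_times_iff:
  assumes "ideal H R"
  shows "proper_radical_ideal T (H \<times> carrier M) \<longleftrightarrow> proper_radical_ideal R H"
proof -
  have pow: "p [^]\<^bsub>T\<^esub> (n::nat) \<in> H \<times> carrier M \<longleftrightarrow> fst p [^] n \<in> H"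
    if p: "p \<in> carrier T" for p n
    using T.nat_pow_closed[OF p, of n] fst_pow_T[OF p, of n]
    by (auto simp: trivial_extension_simps mem_Times_iff)
  have "radical T (H \<times> carrier M)
      = {p \<in> carrier T. \<exists>n::nat. n \<ge> 1 \<and> fst p [^] n \<in> H}"
    unfolding radical_def by (intro Collect_cong conj_cong ex_cong1 refl pow)
  also have "\<dots> = radical R H \<times> carrier M"
    by (auto simp: radical_def trivial_extension_simps(1))
  finally have "radical T (H \<times> carrier M) = radical R H \<times> carrier M" .
  then show ?thesis
    using assms ideal_times[OF assms]
    by (simp add: proper_radical_ideal_def trivial_extension_simps(1))
qed

text \<open>Since \<open>(x, e) (s, 0) = (x s, s e)\<close>, the two components vary independently,
  and the second runs through \<open>s E = E\<close>.\<close>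

lemma PIdl_times:
  assumes "s \<in> S"
  shows "PIdl\<^bsub>T\<^esub> (s, \<zero>\<^bsub>M\<^esub>) = (PIdl s) \<times> carrier M"
proof -
  have "s \<in> carrier R" using assms S_regular by simp
  then have "PIdl\<^bsub>T\<^esub> (s, \<zero>\<^bsub>M\<^esub>) = {(x \<otimes> s, s \<odot>\<^bsub>M\<^esub> e) | x e. x \<in> carrier R \<and> e \<in> carrier M}"
    by (force simp: cgenideal_def trivial_extension_simps)
  also have "\<dots> = (PIdl s) \<times> (\<lambda>e. s \<odot>\<^bsub>M\<^esub> e) ` carrier M"
    by (auto simp: cgenideal_def)
  finally show ?thesis by (simp only: divisible[OF assms, symmetric])
qed

text \<open>For \<open>s\<close> in \<open>J \<inter> S\<close>, both \<open>s\<close> and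
  \<open>(s, \<zero>)\<close> are regular, so each side amounts to the existence of a cofactor whose
  product with the ideal is principal on that element. A cofactor contains the generator of the
  product, so it meets \<open>S\<close>, respectively the regular elements of \<open>T\<close>, and
  the correspondence applies to it.\<close>

lemma invertible_ideal_times_iff:
  assumes J: "ideal J R" "J \<inter> S \<noteq> {}"
  shows "invertible_ideal T (J \<times> carrier M) \<longleftrightarrow> invertible_ideal R J"
proof -
  obtain s where s: "s \<in> J" "s \<in> S" using J by blast
  have s_carr: "s \<in> carrier R" using s S_regular by simp
  have meets: "K \<inter> S \<noteq> {}" if "ideal K R" "ideal_prod R J K = PIdl s" for K
    using R.ideal_prod_inter[OF J(1) that(1)] R.cgenideal_self[OF s_carr] that(2) s by blast
  have "invertible_ideal T (J \<times> carrier M)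
      \<longleftrightarrow> (\<exists>K'. ideal K' T \<and> ideal_prod T (J \<times> carrier M) K' = PIdl\<^bsub>T\<^esub> (s, \<zero>\<^bsub>M\<^esub>))"
    using s by (intro T.invertible_ideal_iff_prod_principal ideal_times J) (auto simp: regular_T_iff)
  also have "\<dots> \<longleftrightarrow> (\<exists>K. ideal K R \<and> ideal_prod R J K = PIdl s)"
  proof
    assume "\<exists>K'. ideal K' T \<and> ideal_prod T (J \<times> carrier M) K' = PIdl\<^bsub>T\<^esub> (s, \<zero>\<^bsub>M\<^esub>)"
    then obtain K' where K': "ideal K' T"
      "ideal_prod T (J \<times> carrier M) K' = PIdl\<^bsub>T\<^esub> (s, \<zero>\<^bsub>M\<^esub>)" by blast
    have "(s, \<zero>\<^bsub>M\<^esub>) \<in> PIdl\<^bsub>T\<^esub> (s, \<zero>\<^bsub>M\<^esub>)"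
      using s_carr by (intro T.cgenideal_self) (simp add: trivial_extension_simps)
    then have "(s, \<zero>\<^bsub>M\<^esub>) \<in> K'"
      using T.ideal_prod_inter[OF ideal_times[OF J(1)] K'(1)] K'(2) by blast
    then have "K' \<inter> regular_elements T \<noteq> {}" using s by (auto simp: regular_T_iff)
    with K'(1) obtain K where K: "K' = K \<times> carrier M" "ideal K R" "K \<inter> S \<noteq> {}"
      by (rule regular_ideal_T_cases)
    then have "ideal_prod R J K \<times> carrier M = (PIdl s) \<times> carrier M"
      using K'(2) J s by (simp add: ideal_prod_times PIdl_times del: times_eq_iff)
    with K show "\<exists>K. ideal K R \<and> ideal_prod R J K = PIdl s" by auto
  next
    assume "\<exists>K. ideal K R \<and> ideal_prod R J K = PIdl s"
    then obtain K where K: "ideal K R" "ideal_prod R J K = PIdl s" by blast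
    then have "ideal_prod T (J \<times> carrier M) (K \<times> carrier M) = PIdl\<^bsub>T\<^esub> (s, \<zero>\<^bsub>M\<^esub>)"
      using J s meets by (simp add: ideal_prod_times PIdl_times)
    with K show "\<exists>K'. ideal K' T \<and> ideal_prod T (J \<times> carrier M) K' = PIdl\<^bsub>T\<^esub> (s, \<zero>\<^bsub>M\<^esub>)"
      using ideal_times by blast
  qed
  also have "\<dots> \<longleftrightarrow> invertible_ideal R J"
    using s S_regular by (intro R.invertible_ideal_iff_prod_principal[symmetric] J) auto
  finally show ?thesis .
qed

section \<open>Transfer of factorizations and of the ISP property\<close>

lemma ISP_factorable_times_iff:
  assumes I: "ideal I R" "I \<inter> S \<noteq> {}"
  shows "ISP_factorable T (I \<times> carrier M) \<longleftrightarrow> ISP_factorable R I"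
proof
  assume "ISP_factorable R I"
  then obtain J Hs where J: "invertible_ideal R J" and Hs: "Hs \<noteq> []"
    "\<forall>H \<in> set Hs. proper_radical_ideal R H" and eq: "I = foldl (ideal_prod R) J Hs"
    unfolding ISP_factorable_def by blast
  have ids: "ideal J R" "\<forall>H \<in> set Hs. ideal H R"
    using J Hs by (auto simp: invertible_ideal_def proper_radical_ideal_def)
  then have meets: "J \<inter> S \<noteq> {}" "\<forall>H \<in> set Hs. H \<inter> S \<noteq> {}"
    using R.foldl_ideal_prod[OF ids] I(2) unfolding eq[symmetric] by blast+
  have "invertible_ideal T (J \<times> carrier M)"
    using J ids meets by (simp add: invertible_ideal_times_iff)
  moreover have "\<forall>H \<in> set (map (\<lambda>H. H \<times> carrier M) Hs). proper_radical_ideal T H"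
    using Hs ids by (simp add: proper_radical_ideal_times_iff)
  moreover have "I \<times> carrier M
      = foldl (ideal_prod T) (J \<times> carrier M) (map (\<lambda>H. H \<times> carrier M) Hs)"
    using ids meets by (simp add: foldl_ideal_prod_times eq)
  ultimately show "ISP_factorable T (I \<times> carrier M)"
    unfolding ISP_factorable_def using Hs(1) by blast
next
  assume "ISP_factorable T (I \<times> carrier M)"
  then obtain J' Hs' where J': "invertible_ideal T J'" and Hs': "Hs' \<noteq> []"
    "\<forall>H \<in> set Hs'. proper_radical_ideal T H"
    and eq: "I \<times> carrier M = foldl (ideal_prod T) J' Hs'"
    unfolding ISP_factorable_def by blast
  have ids: "ideal J' T" "\<forall>H \<in> set Hs'. ideal H T"
    using J' Hs' by (auto simp: invertible_ideal_def proper_radical_ideal_def)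
  have "(I \<times> carrier M) \<inter> regular_elements T \<noteq> {}" using I by (simp add: meets_times_iff)
  then have meets: "J' \<inter> regular_elements T \<noteq> {}" "\<forall>H \<in> set Hs'. H \<inter> regular_elements T \<noteq> {}"
    using T.foldl_ideal_prod[OF ids] unfolding eq[symmetric] by blast+
  obtain J where J: "J' = J \<times> carrier M" "ideal J R" "J \<inter> S \<noteq> {}"
    using ids(1) meets(1) by (rule regular_ideal_T_cases)
  have "\<exists>G. H = G \<times> carrier M \<and> ideal G R \<and> G \<inter> S \<noteq> {}" if "H \<in> set Hs'" for H
  proof -
    have "ideal H T" "H \<inter> regular_elements T \<noteq> {}" using ids(2) meets(2) that by blast+
    then show ?thesis by (rule regular_ideal_T_cases) blast
  qed
  \<comment> \<open>Choosing an ideal of \<open>R\<close> below each factor presents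
    \<open>Hs'\<close> as the image of a list over \<open>R\<close>, the form in which
    \<open>foldl_ideal_prod_times\<close> applies.\<close>
  then obtain G where G: "\<And>H. H \<in> set Hs'
      \<Longrightarrow> H = G H \<times> carrier M \<and> ideal (G H) R \<and> G H \<inter> S \<noteq> {}"
    by metis
  define Hs where "Hs = map G Hs'"
  have Hs'_eq: "Hs' = map (\<lambda>H. H \<times> carrier M) Hs"
    unfolding Hs_def map_map comp_def
    by (rule map_idI[symmetric], rule G[THEN conjunct1, symmetric])
  have Hs: "\<forall>H \<in> set Hs. ideal H R \<and> H \<inter> S \<noteq> {}"
    unfolding Hs_def set_map using G by blast
  have "I = foldl (ideal_prod R) J Hs"
    using eq Hs J unfolding Hs'_eq by (simp add: foldl_ideal_prod_times)
  moreover have "invertible_ideal R J"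
    using J' J by (simp add: invertible_ideal_times_iff)
  moreover have "\<forall>H \<in> set Hs. proper_radical_ideal R H"
    using Hs' Hs unfolding Hs'_eq by (simp add: proper_radical_ideal_times_iff)
  ultimately show "ISP_factorable R I"
    unfolding ISP_factorable_def using Hs'(1) Hs'_eq by blast
qed

lemma ISP_ring_T_iff:
  assumes "\<one> \<noteq> \<zero>"
  shows "ISP_ring T \<longleftrightarrow>
    (\<forall>I. ideal I R \<and> I \<noteq> carrier R \<and> I \<inter> S \<noteq> {} \<longrightarrow> ISP_factorable R I)"
proof -
  have "ISP_ring T \<longleftrightarrow>
      (\<forall>P. ideal P T \<and> P \<inter> regular_elements T \<noteq> {} \<and> P \<noteq> carrier T \<longrightarrow> ISP_factorable T P)"
    using assms T.is_cring by (auto simp: ISP_ring_def regular_ideal_def trivial_extension_simps)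
  \<comment> \<open>The regular ideals \<open>P\<close> of \<open>T\<close> are exactly the sets
    \<open>I \<times> carrier M\<close>, so the quantifier can range over \<open>I\<close>
    instead.\<close>
  also have "\<dots> \<longleftrightarrow> (\<forall>I. ideal I R \<and> I \<inter> S \<noteq> {} \<and> I \<times> carrier M \<noteq> carrier T
      \<longrightarrow> ISP_factorable T (I \<times> carrier M))"
    (is "?L \<longleftrightarrow> ?Q")
  proof
    assume ?L
    then show ?Q by (simp add: ideal_times meets_times_iff)
  next
    assume Q: ?Q
    show ?L
    proof (intro allI impI)
      fix P assume P: "ideal P T \<and> P \<inter> regular_elements T \<noteq> {} \<and> P \<noteq> carrier T"
      then have "ideal P T" "P \<inter> regular_elements T \<noteq> {}" by blast+
      then obtain I where "P = I \<times> carrier M" "ideal I R" "I \<inter> S \<noteq> {}"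
        by (rule regular_ideal_T_cases)
      with Q P show "ISP_factorable T P" by blast
    qed
  qed
  also have "\<dots> \<longleftrightarrow> (\<forall>I. ideal I R \<and> I \<noteq> carrier R \<and> I \<inter> S \<noteq> {} \<longrightarrow> ISP_factorable R I)"
    by (auto simp: ISP_factorable_times_iff trivial_extension_simps(1))
  finally show ?thesis .
qed

end

theorem theorem2p7:
  fixes A :: "('a, 'm) ring_scheme" and E :: "('a, 'e, 'n) module_scheme" and S :: "'a set"
  assumes "cring A" and "\<one>\<^bsub>A\<^esub> \<noteq> \<zero>\<^bsub>A\<^esub>"
    and "module A E"
    and "S = carrier A - (zero_divisors A \<union> zero_divisors_on A E)"
    and "\<And>s. s \<in> S \<Longrightarrow> carrier E = (\<lambda>e. s \<odot>\<^bsub>E\<^esub> e) ` carrier E"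
  shows "ISP_ring (trivial_extension A E) \<longleftrightarrow>
    (\<forall>I. ideal I A \<and> I \<noteq> carrier A \<and> I \<inter> S \<noteq> {} \<longrightarrow>
      (\<exists>J Hs. invertible_ideal A J \<and> Hs \<noteq> [] \<and> (\<forall>H \<in> set Hs. proper_radical_ideal A H) \<and>
        I = foldl (ideal_prod A) J Hs))"
proof -
  interpret module A E by (rule assms(3))
  \<comment> \<open>The obligations are divisibility, with \<open>S\<close> unfolded, and the
    defining equation of \<open>S\<close>.\<close>
  interpret trivial_extension_divisible A E S
    by unfold_locales (rule assms(5)[unfolded assms(4)], assumption, rule eq_reflection, rule assms(4))
  show ?thesis using ISP_ring_T_iff[OF assms(2)] unfolding ISP_factorable_def .
qed

end
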